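(* Let $n\ge 1$, let $N$ be an $n$-dimensional $C^\infty$ manifold without boundary, and let $(f,\nu): N\to\mathbb{R}^{n+1}\times S^n$ be a frontal. Let $x_0\in N$ and $P\in\mathbb{R}^{n+1}$ satisfy $(f(x_0)-P)\cdot\nu(x_0)\neq 0$. Then the map-germ $(f-P): (N,x_0)\to\mathbb{R}^{n+1}$ is an opening of the Gauss map-germ $\widetilde\nu=\frac{f-P}{\|f-P\|}: (N,x_0)\to S^n$ of its anti-orthotomic $\widetilde f: (N,x_0)\to\mathbb{R}^{n+1}$.
   Context: All mappings are of class $C^\infty$; $S^n\subset\mathbb{R}^{n+1}$ is the unit sphere and $\cdot$ the Euclidean scalar product. A mapping $f:N\to\mathbb{R}^{n+1}$ is a frontal if there is a mapping $\nu:N\to S^n$ (its Gauss mapping) with $df_x(\mathbf v)\cdot\nu(x)=0$ for all $x\in N$, $\mathbf v\in T_xN$; the pair $(f,\nu)$ is also called a frontal. Near $x_0$ the condition $(f(x)-P)\cdot\nu(x)\ne 0$ holds, and the anti-orthotomic germ of $f$ relative to $P$ is the frontal-germ $\widetilde f(x)=f(x)-\frac{\|f(x)-P\|^2}{2(f(x)-P)\cdot\nu(x)}\nu(x)$ with Gauss map-germ $\widetilde\nu(x)=\frac{f(x)-P}{\|f(x)-P\|}$. Let $\mathcal{E}_n$ be the ring of $C^\infty$ function-germs on $(\mathbb{R}^n,0)$ and $\Omega^1_n$ the $\mathcal{E}_n$-module of germs of $1$-forms on $(\mathbb{R}^n,0)$. For a $C^\infty$ map-germ $\varphi=(\varphi_1,\dots,\varphi_n):(\mathbb{R}^n,0)\to(\mathbb{R}^n,0)$,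 the Jacobi module $\mathcal{J}_\varphi\subset\Omega^1_n$ is the $\mathcal{E}_n$-submodule generated by $d\varphi_1,\dots,d\varphi_n$, and the ramification module $\mathcal{R}_\varphi$ is the $\varphi^*(\mathcal{E}_n)$-module of all function-germs $\delta$ with $d\delta\in\mathcal{J}_\varphi$. For a function-germ $\delta:(\mathbb{R}^n,0)\to(\mathbb{R},0)$, the map-germ $(\varphi,\delta):(\mathbb{R}^n,0)\to(\mathbb{R}^n\times\mathbb{R},(0,0))$ is called an opening of $\varphi$ if $\delta\in\mathcal{R}_\varphi$. For germs between manifolds these notions are used via local coordinates (with base points translated to the origin). Here $f-P$, which does not vanish near $x_0$, is regarded through the diffeomorphism $\mathbb{R}^{n+1}\setminus\{0\}\cong S^n\times\mathbb{R}_{+}$, $y\mapsto (y/\|y\|,\|y\|)$, as the map-germ $(\widetilde\nu,\|f-P\|)$; thus "$f-P$ is an opening of $\widetilde\nu$" means $\|f-P\|\in\mathcal{R}_{\widetilde\nu}$, i.e. $d\|f-P\|\in\mathcal{J}_{\widetilde\nu}$ at $x_0$. *)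

theory Defs
  imports "HOL-Analysis.Analysis"
begin

section \<open>Smooth maps between Euclidean spaces\<close>

text \<open>
  Both notions are meant for open \<open>S\<close>: the derivatives are full, not relative to \<open>S\<close>.
\<close>

fun Ck_on :: "nat \<Rightarrow> 'a::euclidean_space set \<Rightarrow> ('a \<Rightarrow> 'b::real_normed_vector) \<Rightarrow> bool" where
  "Ck_on 0 S f \<longleftrightarrow> continuous_on S f"
| "Ck_on (Suc k) S f \<longleftrightarrow>
     (\<forall>x\<in>S. f differentiable (at x)) \<and> (\<forall>v. Ck_on k S (\<lambda>x. frechet_derivative f (at x) v))"

definition smooth_on :: "'a::euclidean_space set \<Rightarrow> ('a \<Rightarrow> 'b::real_normed_vector) \<Rightarrow> bool" where
  "smooth_on S f \<longleftrightarrow> (\<forall>k. Ck_on k S f)"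

definition smooth_germ :: "('a::euclidean_space \<Rightarrow> 'b::real_normed_vector) \<Rightarrow> 'a \<Rightarrow> bool" where
  "smooth_germ f x \<longleftrightarrow> (\<exists>U. open U \<and> x \<in> U \<and> smooth_on U f)"

lemma frechet_derivative_cong_open:
  assumes "open S" "x \<in> S" "\<And>y. y \<in> S \<Longrightarrow> f y = g y" "f differentiable (at x)"
  shows "g differentiable (at x)" "frechet_derivative g (at x) = frechet_derivative f (at x)"
proof -
  have "(f has_derivative frechet_derivative f (at x)) (at x)"
    using assms(4) frechet_derivative_works by blast
  then have *: "(g has_derivative frechet_derivative f (at x)) (at x)"
    using has_derivative_transform_within_open assms(1-3) by blast
  then show "g differentiable (at x)" by (rule differentiableI)
  show "frechet_derivative g (at x) = frechet_derivative f (at x)"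
    using frechet_derivative_at[OF *] by simp
qed

lemma Ck_on_cong:
  assumes "open S" "\<And>y. y \<in> S \<Longrightarrow> f y = g y" "Ck_on k S f"
  shows "Ck_on k S g"
  using assms(2,3)
proof (induction k arbitrary: f g)
  case 0
  then show ?case by (metis Ck_on.simps(1) continuous_on_cong)
next
  case (Suc k)
  note d = frechet_derivative_cong_open[OF assms(1) _ Suc.prems(1)]
  have "Ck_on k S (\<lambda>x. frechet_derivative g (at x) v)" for v
    by (rule Suc.IH[of "\<lambda>x. frechet_derivative f (at x) v"]) (use Suc.prems d in auto)
  then show ?case using d Suc.prems by auto
qed

lemma Ck_on_SucD: "Ck_on (Suc k) S f \<Longrightarrow> Ck_on k S f"
proof (induction k arbitrary: f)
  case 0
  then show ?case
    by (auto intro!: continuous_at_imp_continuous_on differentiable_imp_continuous_within)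
next
  case (Suc k)
  then show ?case by (metis Ck_on.simps(2))
qed

lemma Ck_on_SucI:
  assumes "open S" "\<And>x. x \<in> S \<Longrightarrow> (f has_derivative f' x) (at x)"
    "\<And>v. Ck_on k S (\<lambda>x. f' x v)"
  shows "Ck_on (Suc k) S f"
proof -
  have "frechet_derivative f (at x) = f' x" if "x \<in> S" for x
    using frechet_derivative_at[OF assms(2)[OF that]] by simp
  then have "Ck_on k S (\<lambda>x. frechet_derivative f (at x) v)" for v
    using Ck_on_cong[OF assms(1) _ assms(3)[of v]] by simp
  then show ?thesis using assms(2) by (auto simp: differentiable_def)
qed

lemma Ck_on_derivative:
  assumes "Ck_on (Suc k) S f" "x \<in> S"
  shows "(f has_derivative frechet_derivative f (at x)) (at x)"
  using assms frechet_derivative_works by auto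

lemma Ck_on_subset: "Ck_on k S f \<Longrightarrow> T \<subseteq> S \<Longrightarrow> Ck_on k T f"
  by (induction k arbitrary: f) (auto intro: continuous_on_subset)

lemma Ck_on_local:
  assumes "\<And>x. x \<in> S \<Longrightarrow> \<exists>T. open T \<and> x \<in> T \<and> Ck_on k T f"
  shows "Ck_on k S f"
  using assms
proof (induction k arbitrary: f)
  case 0
  then show ?case
    by (simp add: continuous_on_eq_continuous_at)
       (metis continuous_at_imp_continuous_on continuous_on_eq_continuous_at)
next
  case (Suc k)
  have "Ck_on k S (\<lambda>x. frechet_derivative f (at x) v)" for v
    by (rule Suc.IH) (use Suc.prems in fastforce)
  then show ?case using Suc.prems by fastforce
qed

lemma Ck_on_const: "Ck_on k S (\<lambda>x. c)"
  by (induction k arbitrary: c) auto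

lemma Ck_on_linear:
  assumes "open S" "bounded_linear L"
  shows "Ck_on k S L"
proof (cases k)
  case 0
  then show ?thesis by (simp add: assms(2) linear_continuous_on)
next
  case (Suc j)
  show ?thesis unfolding Suc
    by (rule Ck_on_SucI[where f' = "\<lambda>x. L"])
       (use assms Ck_on_const bounded_linear_imp_has_derivative in auto)
qed

lemma Ck_on_add:
  assumes "open S" "Ck_on k S f" "Ck_on k S g"
  shows "Ck_on k S (\<lambda>x. f x + g x)"
  using assms(2,3)
proof (induction k arbitrary: f g)
  case 0
  then show ?case by (simp add: continuous_on_add)
next
  case (Suc k)
  show ?case
    by (rule Ck_on_SucI[where f' = "\<lambda>x v. frechet_derivative f (at x) v + frechet_derivative g (at x) v"])
       (use assms(1) Suc in \<open>auto intro!: has_derivative_add Ck_on_derivative simp del: Ck_on.simps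
           intro: Suc.IH[OF Ck_on.simps(2)[THEN iffD1, THEN conjunct2, THEN spec]
             Ck_on.simps(2)[THEN iffD1, THEN conjunct2, THEN spec]]\<close>)
qed

lemma Ck_on_sum:
  assumes "open S" "\<And>i. i \<in> I \<Longrightarrow> Ck_on k S (f i)"
  shows "Ck_on k S (\<lambda>x. \<Sum>i\<in>I. f i x)"
  using assms(2)
  by (induction I rule: infinite_finite_induct) (auto simp: Ck_on_const intro: Ck_on_add[OF assms(1)])

lemma Ck_on_bilinear:
  assumes "open S" "bounded_bilinear B" "Ck_on k S f" "Ck_on k S g"
  shows "Ck_on k S (\<lambda>x. B (f x) (g x))"
  using assms(3,4)
proof (induction k arbitrary: f g)
  case 0
  then show ?case using bounded_bilinear.continuous_on[OF assms(2)] by auto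
next
  case (Suc k)
  note d = Suc.prems[THEN Ck_on.simps(2)[THEN iffD1, THEN conjunct2, THEN spec]]
  have "Ck_on k S (\<lambda>x. B (f x) (frechet_derivative g (at x) v) + B (frechet_derivative f (at x) v) (g x))" for v
    by (intro Ck_on_add assms(1) Suc.IH d Suc.prems[THEN Ck_on_SucD])
  moreover have "((\<lambda>x. B (f x) (g x)) has_derivative
      (\<lambda>v. B (f x) (frechet_derivative g (at x) v) + B (frechet_derivative f (at x) v) (g x))) (at x)"
    if "x \<in> S" for x
    using bounded_bilinear.FDERIV[OF assms(2)] Suc.prems[THEN Ck_on_derivative, OF that] by blast
  ultimately show ?case by (rule Ck_on_SucI[OF assms(1), rotated])
qed

lemma Ck_on_inverse:
  fixes f :: "'a::euclidean_space \<Rightarrow> real"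
  assumes "open S" "Ck_on k S f" "\<And>x. x \<in> S \<Longrightarrow> f x \<noteq> 0"
  shows "Ck_on k S (\<lambda>x. inverse (f x))"
  using assms(2)
proof (induction k)
  case 0
  then show ?case using assms(3) by (auto intro: continuous_on_inverse)
next
  case (Suc k)
  note d = Suc.prems[THEN Ck_on.simps(2)[THEN iffD1, THEN conjunct2, THEN spec]]
  note i = Suc.IH[OF Suc.prems[THEN Ck_on_SucD]]
  have "Ck_on k S (\<lambda>x. (- 1) * (inverse (f x) * frechet_derivative f (at x) v * inverse (f x)))" for v
    by (intro Ck_on_bilinear[OF assms(1) bounded_bilinear_mult] Ck_on_const d i)
  then have "Ck_on k S (\<lambda>x. - (inverse (f x) * frechet_derivative f (at x) v * inverse (f x)))" for v
    by simp
  moreover have "((\<lambda>x. inverse (f x)) has_derivative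
      (\<lambda>v. - (inverse (f x) * frechet_derivative f (at x) v * inverse (f x)))) (at x)"
    if "x \<in> S" for x
    by (rule Deriv.has_derivative_inverse) (use assms(3) Ck_on_derivative[OF Suc.prems] that in auto)
  ultimately show ?case by (rule Ck_on_SucI[OF assms(1), rotated])
qed

lemma Ck_on_sqrt:
  fixes f :: "'a::euclidean_space \<Rightarrow> real"
  assumes "open S" "Ck_on k S f" "\<And>x. x \<in> S \<Longrightarrow> f x > 0"
  shows "Ck_on k S (\<lambda>x. sqrt (f x))"
  using assms(2)
proof (induction k)
  case 0
  then show ?case by (auto intro: continuous_on_real_sqrt)
next
  case (Suc k)
  note d = Suc.prems[THEN Ck_on.simps(2)[THEN iffD1, THEN conjunct2, THEN spec]]
  have i: "Ck_on k S (\<lambda>x. inverse (sqrt (f x)))"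
    by (rule Ck_on_inverse[OF assms(1) Suc.IH[OF Suc.prems[THEN Ck_on_SucD]]]) (use assms(3) in force)
  have "Ck_on k S (\<lambda>x. frechet_derivative f (at x) v * (inverse (sqrt (f x)) * (1/2)))" for v
    by (intro Ck_on_bilinear[OF assms(1) bounded_bilinear_mult] Ck_on_const d i)
  moreover have "((\<lambda>x. sqrt (f x)) has_derivative
      (\<lambda>v. frechet_derivative f (at x) v * (inverse (sqrt (f x)) * (1/2)))) (at x)"
    if "x \<in> S" for x
    using has_derivative_real_sqrt[OF assms(3)[OF that] Ck_on_derivative[OF Suc.prems that]]
    by (simp add: field_simps)
  ultimately show ?case by (rule Ck_on_SucI[OF assms(1), rotated])
qed

lemma Ck_on_compose:
  fixes f :: "'b::euclidean_space \<Rightarrow> 'c::real_normed_vector" and g :: "'a::euclidean_space \<Rightarrow> 'b"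
  assumes "open S" "open T" "Ck_on k S g" "Ck_on k T f" "g ` S \<subseteq> T"
  shows "Ck_on k S (\<lambda>x. f (g x))"
  using assms(3,4)
proof (induction k arbitrary: f)
  case 0
  then show ?case using continuous_on_compose2 assms(5) by auto
next
  case (Suc k)
  note d = Suc.prems[THEN Ck_on.simps(2)[THEN iffD1, THEN conjunct2, THEN spec]]
  let ?D = "\<lambda>x v. \<Sum>b\<in>Basis. (frechet_derivative g (at x) v \<bullet> b) *\<^sub>R frechet_derivative f (at (g x)) b"
  have "Ck_on k S (\<lambda>x. ?D x v)" for v
    by (rule Ck_on_sum[OF assms(1)], rule Ck_on_bilinear[OF assms(1) bounded_bilinear_scaleR
          Ck_on_bilinear[OF assms(1) bounded_bilinear_inner d(1) Ck_on_const]
          Suc.IH[OF Suc.prems(1)[THEN Ck_on_SucD] d(2)]])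
  moreover have "((\<lambda>x. f (g x)) has_derivative ?D x) (at x)" if "x \<in> S" for x
  proof -
    have gx: "g x \<in> T" using assms(5) that by auto
    have df: "(f has_derivative frechet_derivative f (at (g x))) (at (g x))"
      using Ck_on_derivative[OF Suc.prems(2) gx] .
    have "((\<lambda>x. f (g x)) has_derivative
        (\<lambda>v. frechet_derivative f (at (g x)) (frechet_derivative g (at x) v))) (at x)"
      using has_derivative_compose[OF Ck_on_derivative[OF Suc.prems(1) that] df] .
    moreover have expand: "frechet_derivative f (at (g x)) w
        = (\<Sum>b\<in>Basis. (w \<bullet> b) *\<^sub>R frechet_derivative f (at (g x)) b)" for w
    proof -
      have l: "linear (frechet_derivative f (at (g x)))"
        using df has_derivative_linear by blast
      have "frechet_derivative f (at (g x)) w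
          = frechet_derivative f (at (g x)) (\<Sum>b\<in>Basis. (w \<bullet> b) *\<^sub>R b)"
        by (simp add: euclidean_representation)
      then show ?thesis by (simp only: linear_sum[OF l] linear_cmul[OF l])
    qed
    ultimately show ?thesis by (subst (asm) expand)
  qed
  ultimately show ?case by (rule Ck_on_SucI[OF assms(1), rotated])
qed

lemma smooth_on_imp_continuous_on: "smooth_on S f \<Longrightarrow> continuous_on S f"
  unfolding smooth_on_def using Ck_on.simps(1) by blast

lemma smooth_on_has_derivative:
  "smooth_on S f \<Longrightarrow> x \<in> S \<Longrightarrow> (f has_derivative frechet_derivative f (at x)) (at x)"
  unfolding smooth_on_def using Ck_on_derivative by blast

lemma smooth_on_subset: "smooth_on S f \<Longrightarrow> T \<subseteq> S \<Longrightarrow> smooth_on T f"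
  unfolding smooth_on_def using Ck_on_subset by blast

lemma smooth_on_cong:
  "open S \<Longrightarrow> (\<And>y. y \<in> S \<Longrightarrow> f y = g y) \<Longrightarrow> smooth_on S f \<Longrightarrow> smooth_on S g"
  unfolding smooth_on_def using Ck_on_cong by blast

lemma smooth_on_local:
  "(\<And>x. x \<in> S \<Longrightarrow> \<exists>T. open T \<and> x \<in> T \<and> smooth_on T f) \<Longrightarrow> smooth_on S f"
  unfolding smooth_on_def by (meson Ck_on_local)

lemma smooth_on_const: "smooth_on S (\<lambda>x. c)"
  unfolding smooth_on_def using Ck_on_const by blast

lemma smooth_on_linear: "open S \<Longrightarrow> bounded_linear L \<Longrightarrow> smooth_on S L"
  unfolding smooth_on_def using Ck_on_linear by blast

lemma smooth_on_bilinear: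
  "open S \<Longrightarrow> bounded_bilinear B \<Longrightarrow> smooth_on S f \<Longrightarrow> smooth_on S g
    \<Longrightarrow> smooth_on S (\<lambda>x. B (f x) (g x))"
  unfolding smooth_on_def using Ck_on_bilinear by blast

lemma smooth_on_add:
  "open S \<Longrightarrow> smooth_on S f \<Longrightarrow> smooth_on S g \<Longrightarrow> smooth_on S (\<lambda>x. f x + g x)"
  unfolding smooth_on_def using Ck_on_add by blast

lemma smooth_on_minus:
  assumes "open S" "smooth_on S f" "smooth_on S g"
  shows "smooth_on S (\<lambda>x. f x - g x)"
proof -
  have "smooth_on S (\<lambda>x. f x + (- 1) *\<^sub>R g x)"
    by (intro smooth_on_add smooth_on_bilinear[OF _ bounded_bilinear_scaleR] smooth_on_const assms)
  then show ?thesis by simp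
qed

lemma smooth_on_inverse:
  fixes f :: "'a::euclidean_space \<Rightarrow> real"
  shows "open S \<Longrightarrow> smooth_on S f \<Longrightarrow> (\<And>x. x \<in> S \<Longrightarrow> f x \<noteq> 0) \<Longrightarrow> smooth_on S (\<lambda>x. inverse (f x))"
  unfolding smooth_on_def using Ck_on_inverse by blast

lemma smooth_on_norm:
  fixes f :: "'a::euclidean_space \<Rightarrow> 'b::real_inner"
  assumes "open S" "smooth_on S f" "\<And>x. x \<in> S \<Longrightarrow> f x \<noteq> 0"
  shows "smooth_on S (\<lambda>x. norm (f x))"
proof -
  have "smooth_on S (\<lambda>x. f x \<bullet> f x)"
    using smooth_on_bilinear[OF assms(1) bounded_bilinear_inner assms(2) assms(2)] .
  then have "smooth_on S (\<lambda>x. sqrt (f x \<bullet> f x))"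
    unfolding smooth_on_def using Ck_on_sqrt[OF assms(1)] assms(3) by (simp add: smooth_on_def)
  then show ?thesis by (simp add: norm_eq_sqrt_inner)
qed

lemma smooth_on_compose:
  fixes f :: "'b::euclidean_space \<Rightarrow> 'c::real_normed_vector" and g :: "'a::euclidean_space \<Rightarrow> 'b"
  shows "open S \<Longrightarrow> open T \<Longrightarrow> smooth_on S g \<Longrightarrow> smooth_on T f \<Longrightarrow> g ` S \<subseteq> T
    \<Longrightarrow> smooth_on S (\<lambda>x. f (g x))"
  unfolding smooth_on_def using Ck_on_compose by blast

section \<open>Smooth manifolds\<close>

text \<open>
  A chart is a pair of its domain and its coordinate map; outside the domain the values of the
  coordinate map are irrelevant.
\<close>

definition chart :: "'a topology \<Rightarrow> 'a set \<Rightarrow> ('a \<Rightarrow> real^'n) \<Rightarrow> bool" where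
  "chart X U \<kappa> \<longleftrightarrow> openin X U \<and> open (\<kappa> ` U) \<and>
     homeomorphic_map (subtopology X U) (top_of_set (\<kappa> ` U)) \<kappa>"

text \<open>
  The atlas of a manifold need not be maximal, but may be. The dimension is \<open>CARD('n)\<close>.
\<close>

definition smooth_manifold :: "'a topology \<Rightarrow> ('a set \<times> ('a \<Rightarrow> real^'n)) set \<Rightarrow> bool" where
  "smooth_manifold X A \<longleftrightarrow>
     Hausdorff_space X \<and> second_countable X \<and>
     (\<forall>(U, \<kappa>)\<in>A. chart X U \<kappa>) \<and> \<Union>(fst ` A) = topspace X \<and>
     (\<forall>(U, \<kappa>)\<in>A. \<forall>(V, \<psi>)\<in>A. smooth_on (\<kappa> ` (U \<inter> V)) (\<psi> \<circ> inv_into U \<kappa>))"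

definition smooth_map_on ::
  "('a set \<times> ('a \<Rightarrow> real^'n)) set \<Rightarrow> 'a set \<Rightarrow> ('a \<Rightarrow> real^'m) \<Rightarrow> bool" where
  "smooth_map_on A W f \<longleftrightarrow> (\<forall>(U, \<kappa>)\<in>A. smooth_on (\<kappa> ` (U \<inter> W)) (f \<circ> inv_into U \<kappa>))"

text \<open>
  The unit sphere as a submanifold: the charts are all its diffeomorphisms between an open subset
  and an open subset of \<open>\<real>\<^sup>n\<close>, a map on a subset of Euclidean space being smooth if it extends
  locally to a smooth map on an open set.
\<close>

definition sphere_charts :: "((real^'m) set \<times> (real^'m \<Rightarrow> real^'n)) set" where
  "sphere_charts = {(V, \<psi>). chart (top_of_set (sphere 0 1)) V \<psi> \<and>
     smooth_on (\<psi> ` V) (inv_into V \<psi>) \<and>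
     (\<forall>q\<in>V. \<exists>W h. open W \<and> q \<in> W \<and> smooth_on W h \<and> (\<forall>p\<in>W \<inter> V. h p = \<psi> p))}"

lemma chart_inj: "chart X U \<kappa> \<Longrightarrow> inj_on \<kappa> U"
  unfolding chart_def homeomorphic_map_def
  by (metis openin_subset topspace_subtopology_subset)

lemma chart_open_image:
  assumes "chart X U \<kappa>" "openin X W"
  shows "open (\<kappa> ` (U \<inter> W))"
proof -
  have h: "homeomorphic_map (subtopology X U) (top_of_set (\<kappa> ` U)) \<kappa>" and o: "open (\<kappa> ` U)"
    using assms(1) by (auto simp: chart_def)
  have "openin (subtopology X U) (U \<inter> W)"
    using assms(2) by (simp add: openin_subtopology_Int2)
  then have "openin (top_of_set (\<kappa> ` U)) (\<kappa> ` (U \<inter> W))"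
    using homeomorphic_imp_open_map[OF h] by (simp add: open_map_def)
  then show ?thesis using o by (simp add: openin_open_eq)
qed

lemma sphere_chart_exists:
  fixes p :: "real^'m"
  assumes card: "CARD('m) = CARD('n) + 1" and p: "norm p = 1"
  shows "\<exists>(V, \<psi> :: real^'m \<Rightarrow> real^'n)\<in>sphere_charts. p \<in> V"
proof -
  have pp: "p \<bullet> p = 1" using p by (simp add: dot_square_norm)
  have pnz: "p \<noteq> 0" using p by auto
  have dim: "dim (UNIV :: (real^'n) set) = dim {x. p \<bullet> x = 0}"
    using dim_hyperplane[OF pnz] card by simp
  obtain L :: "real^'n \<Rightarrow> real^'m" and G where LG: "linear L" "linear G"
      "L ` UNIV = {x. p \<bullet> x = 0}" "G ` {x. p \<bullet> x = 0} = UNIV"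
      "\<And>x. x \<in> UNIV \<Longrightarrow> norm (L x) = norm x"
      "\<And>y. y \<in> {x. p \<bullet> x = 0} \<Longrightarrow> norm (G y) = norm y"
      "\<And>x. x \<in> UNIV \<Longrightarrow> G (L x) = x"
      "\<And>y. y \<in> {x. p \<bullet> x = 0} \<Longrightarrow> L (G y) = y"
    by (rule isometries_subspaces[OF subspace_UNIV subspace_hyperplane dim], rule that)
  have bL: "bounded_linear L" and bG: "bounded_linear G"
    using LG(1,2) by (simp_all only: linear_conv_bounded_linear)
  have pL: "p \<bullet> L y = 0" for y using LG(3) rangeI[of L y] by simp
  define V where "V = {q \<in> sphere 0 1. p \<bullet> q > 0}"
  define O' where "O' = {q. p \<bullet> q > 0}"
  define \<psi> where "\<psi> q = G (inverse (p \<bullet> q) *\<^sub>R q - p)" for q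
  define \<theta> where "\<theta> y = inverse (norm (p + L y)) *\<^sub>R (p + L y)" for y
  have nz: "p + L y \<noteq> 0" for y
  proof
    assume "p + L y = 0"
    then have "p \<bullet> (p + L y) = 0" by simp
    then show False using pL pp by (simp add: inner_add_right)
  qed
  have p\<theta>: "p \<bullet> \<theta> y = inverse (norm (p + L y))" for y
    by (simp add: \<theta>_def inner_add_right pL pp)
  have \<theta>V: "\<theta> y \<in> V" for y
    using nz[of y] by (simp add: V_def p\<theta>) (simp add: \<theta>_def)
  have \<psi>\<theta>: "\<psi> (\<theta> y) = y" for y
    using nz[of y] by (simp add: \<psi>_def p\<theta>) (simp add: \<theta>_def LG(7))
  have \<theta>\<psi>: "\<theta> (\<psi> q) = q" if "q \<in> V" for q
  proof -
    have q: "norm q = 1" "p \<bullet> q > 0" using that by (auto simp: V_def)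
    have "L (\<psi> q) = inverse (p \<bullet> q) *\<^sub>R q - p"
      unfolding \<psi>_def by (rule LG(8)) (use q pp in \<open>simp add: inner_diff_right\<close>)
    then have "p + L (\<psi> q) = inverse (p \<bullet> q) *\<^sub>R q" by simp
    then show ?thesis using q by (simp add: \<theta>_def)
  qed
  have im: "\<psi> ` V = UNIV"
    using \<theta>V \<psi>\<theta> by (metis image_eqI UNIV_eq_I)
  have opO: "open O'" unfolding O'_def by (simp add: open_halfspace_gt)
  have VO: "V = sphere 0 1 \<inter> O'" by (auto simp: V_def O'_def)
  have sip: "smooth_on O' (\<lambda>q. p \<bullet> q)"
    using smooth_on_linear[OF opO bounded_linear_inner_right] .
  have sid: "smooth_on O' (\<lambda>q. q)"
    using smooth_on_linear[OF opO bounded_linear_ident] .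
  have "smooth_on O' (\<lambda>q. inverse (p \<bullet> q) *\<^sub>R q - p)"
    by (intro smooth_on_minus smooth_on_bilinear[OF opO bounded_bilinear_scaleR] smooth_on_inverse
        smooth_on_const opO sip sid) (auto simp: O'_def)
  then have s\<psi>: "smooth_on O' \<psi>"
    unfolding \<psi>_def
    by (rule smooth_on_compose[OF opO open_UNIV _ smooth_on_linear[OF open_UNIV bG]]) auto
  have sL: "smooth_on UNIV (\<lambda>y. p + L y)"
    by (intro smooth_on_add smooth_on_const smooth_on_linear bL open_UNIV)
  have s\<theta>: "smooth_on UNIV \<theta>"
    unfolding \<theta>_def
    by (intro smooth_on_bilinear[OF open_UNIV bounded_bilinear_scaleR] smooth_on_inverse
        smooth_on_norm sL open_UNIV) (use nz in auto)
  have inj: "inj_on \<psi> V" using \<theta>\<psi> by (metis inj_onI)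
  have inv: "inv_into V \<psi> y = \<theta> y" for y
    using inv_into_f_f[OF inj \<theta>V] \<psi>\<theta> by metis
  have "homeomorphic_maps (top_of_set V) (top_of_set UNIV) \<psi> \<theta>"
    unfolding homeomorphic_maps_def
    using smooth_on_imp_continuous_on[OF s\<psi>] smooth_on_imp_continuous_on[OF s\<theta>] \<theta>V \<psi>\<theta> \<theta>\<psi>
    by (auto simp: continuous_map_in_subtopology VO intro: continuous_on_subset)
  then have hom: "homeomorphic_map (top_of_set V) (top_of_set UNIV) \<psi>"
    using homeomorphic_maps_map by blast
  have VS: "sphere 0 1 \<inter> V = V" by (auto simp: V_def)
  have "openin (top_of_set (sphere 0 1)) V"
    unfolding VO using opO by (simp add: openin_open_Int)
  then have "chart (top_of_set (sphere 0 1)) V \<psi>"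
    unfolding chart_def im using hom by (simp add: subtopology_subtopology VS)
  moreover have "smooth_on (\<psi> ` V) (inv_into V \<psi>)"
    unfolding im using s\<theta> inv by (metis (no_types, lifting) ext)
  ultimately have "(V, \<psi>) \<in> sphere_charts"
    unfolding sphere_charts_def using opO s\<psi> VO by blast
  moreover have "p \<in> V" using p pp by (simp add: V_def)
  ultimately show ?thesis by blast
qed

lemma smooth_manifold_sphere:
  assumes "CARD('m) = CARD('n) + 1"
  shows "smooth_manifold (top_of_set (sphere 0 1))
    (sphere_charts :: ((real^'m) set \<times> (real^'m \<Rightarrow> real^'n)) set)"
proof -
  let ?S = "sphere 0 1 :: (real^'m) set"
  have "Hausdorff_space (top_of_set ?S)"
    by (simp add: Hausdorff_space_subtopology)
  moreover have "second_countable (top_of_set ?S)"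
  proof (rule second_countable_subtopology)
    obtain \<B> :: "(real^'m) set set" where B: "countable \<B>" "\<And>b. b \<in> \<B> \<Longrightarrow> open b"
      "\<And>S. open S \<Longrightarrow> \<exists>B'. B' \<subseteq> \<B> \<and> S = \<Union>B'"
      using univ_second_countable by blast
    have "\<exists>V\<in>\<B>. x \<in> V \<and> V \<subseteq> S" if "open S" "x \<in> S" for S x
      using B(3)[OF that(1)] that(2) by blast
    then show "second_countable (euclidean :: (real^'m) topology)"
      unfolding second_countable_def using B(1,2) by (intro exI[of _ \<B>]) auto
  qed
  moreover have "\<Union>(fst ` (sphere_charts :: ((real^'m) set \<times> (real^'m \<Rightarrow> real^'n)) set)) = ?S"
  proof (intro equalityI subsetI)
    fix q :: "real^'m" assume "q \<in> \<Union>(fst ` (sphere_charts :: ((real^'m) set \<times> (real^'m \<Rightarrow> real^'n)) set))"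
    then obtain V and \<psi> :: "real^'m \<Rightarrow> real^'n" where "(V, \<psi>) \<in> sphere_charts" "q \<in> V" by auto
    then show "q \<in> ?S"
      unfolding sphere_charts_def chart_def using openin_imp_subset by fastforce
  next
    fix q :: "real^'m" assume "q \<in> ?S"
    then show "q \<in> \<Union>(fst ` (sphere_charts :: ((real^'m) set \<times> (real^'m \<Rightarrow> real^'n)) set))"
      using sphere_chart_exists[OF assms, of q] by force
  qed
  moreover have "smooth_on (\<kappa> ` (U \<inter> V)) (\<psi> \<circ> inv_into U \<kappa>)"
    if "(U, \<kappa>) \<in> sphere_charts" "(V, \<psi>) \<in> sphere_charts"
    for U V and \<kappa> \<psi> :: "real^'m \<Rightarrow> real^'n"
  proof (rule smooth_on_local)
    fix y assume y: "y \<in> \<kappa> ` (U \<inter> V)"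
    have cU: "chart (top_of_set ?S) U \<kappa>" and sU: "smooth_on (\<kappa> ` U) (inv_into U \<kappa>)"
      and cV: "chart (top_of_set ?S) V \<psi>"
      using that by (auto simp: sphere_charts_def)
    let ?i = "inv_into U \<kappa>"
    note V_chart = that(2)
    have i: "?i z \<in> U \<inter> V" if "z \<in> \<kappa> ` (U \<inter> V)" for z
      using that chart_inj[OF cU] by auto
    have oUV: "open (\<kappa> ` (U \<inter> V))"
      by (rule chart_open_image[OF cU]) (use cV in \<open>simp add: chart_def\<close>)
    obtain W h where W: "open W" "?i y \<in> W" "smooth_on W h" "\<forall>p\<in>W \<inter> V. h p = \<psi> p"
      using V_chart i[OF y] by (fastforce simp: sphere_charts_def)
    define T where "T = \<kappa> ` (U \<inter> V) \<inter> ?i -` W"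
    have s: "smooth_on (\<kappa> ` (U \<inter> V)) ?i"
      by (rule smooth_on_subset[OF sU]) auto
    have oT: "open T"
      unfolding T_def using continuous_open_preimage[OF smooth_on_imp_continuous_on[OF s] oUV W(1)] .
    have "smooth_on T (\<lambda>z. h (?i z))"
      by (rule smooth_on_compose[OF oT W(1) smooth_on_subset[OF s] W(3)]) (auto simp: T_def)
    then have "smooth_on T (\<psi> \<circ> ?i)"
      by (rule smooth_on_cong[OF oT, rotated]) (use W(4) i in \<open>auto simp: T_def\<close>)
    then show "\<exists>T. open T \<and> y \<in> T \<and> smooth_on T (\<psi> \<circ> ?i)"
      using oT y W(2) by (auto simp: T_def)
  qed
  ultimately show ?thesis
    unfolding smooth_manifold_def by (auto simp: sphere_charts_def)
qed

section \<open>Frontals and anti-orthotomics\<close>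

text \<open>
  The differential of \<open>f\<close> at \<open>x\<close> is evaluated on all tangent vectors by means of the
  charts around \<open>x\<close>, each of which identifies the tangent space with \<open>\<real>\<^sup>n\<close>.
\<close>

definition frontal_on ::
  "('a set \<times> ('a \<Rightarrow> real^'n)) set \<Rightarrow> 'a set \<Rightarrow> ('a \<Rightarrow> real^'m) \<times> ('a \<Rightarrow> real^'m) \<Rightarrow> bool" where
  "frontal_on A W = (\<lambda>(f, \<nu>).
     smooth_map_on A W f \<and> smooth_map_on A W \<nu> \<and> \<nu> ` W \<subseteq> sphere 0 1 \<and>
     (\<forall>x\<in>W. \<forall>(U, \<kappa>)\<in>A. x \<in> U \<longrightarrow>
        (\<forall>v. frechet_derivative (f \<circ> inv_into U \<kappa>) (at (\<kappa> x)) v \<bullet> \<nu> x = 0)))"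

definition anti_orthotomic ::
  "real^'m \<Rightarrow> ('a \<Rightarrow> real^'m) \<times> ('a \<Rightarrow> real^'m) \<Rightarrow> ('a \<Rightarrow> real^'m) \<times> ('a \<Rightarrow> real^'m)" where
  "anti_orthotomic P = (\<lambda>(f, \<nu>).
     (\<lambda>x. f x - ((norm (f x - P))\<^sup>2 / (2 * ((f x - P) \<bullet> \<nu> x))) *\<^sub>R \<nu> x,
      \<lambda>x. (f x - P) /\<^sub>R norm (f x - P)))"

lemma frontal_on_anti_orthotomic:
  fixes f \<nu> :: "'a \<Rightarrow> real^'m" and A :: "('a set \<times> ('a \<Rightarrow> real^'n)) set"
  assumes M: "smooth_manifold X A" and F: "frontal_on A (topspace X) (f, \<nu>)"
    and W: "openin X W" "\<And>x. x \<in> W \<Longrightarrow> (f x - P) \<bullet> \<nu> x \<noteq> 0"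
  shows "frontal_on A W (anti_orthotomic P (f, \<nu>))"
proof -
  have WX: "W \<subseteq> topspace X" using W(1) openin_subset by blast
  let ?l = "\<lambda>g n. (norm g)\<^sup>2 / (2 * (g \<bullet> n))"
  let ?a = "\<lambda>x. f x - ?l (f x - P) (\<nu> x) *\<^sub>R \<nu> x"
  let ?b = "\<lambda>x. (f x - P) /\<^sub>R norm (f x - P)"
  have gnz: "f x - P \<noteq> 0" if "x \<in> W" for x using W(2)[OF that] by auto
  have main: "smooth_on (\<kappa> ` (U \<inter> W)) (?a \<circ> inv_into U \<kappa>) \<and>
      smooth_on (\<kappa> ` (U \<inter> W)) (?b \<circ> inv_into U \<kappa>) \<and>
      (\<forall>x\<in>W. x \<in> U \<longrightarrow> (\<forall>v. frechet_derivative (?a \<circ> inv_into U \<kappa>) (at (\<kappa> x)) v \<bullet> ?b x = 0))"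
    if UA: "(U, \<kappa>) \<in> A" for U \<kappa>
  proof -
    have c: "chart X U \<kappa>" using M UA by (auto simp: smooth_manifold_def)
    let ?i = "inv_into U \<kappa>"
    define S where "S = \<kappa> ` (U \<inter> W)"
    have oS: "open S" unfolding S_def using chart_open_image[OF c W(1)] .
    have iW: "?i y \<in> W" if "y \<in> S" for y
      using that chart_inj[OF c] by (auto simp: S_def)
    have Ssub: "S \<subseteq> \<kappa> ` (U \<inter> topspace X)" using WX by (auto simp: S_def)
    have sf: "smooth_on S (\<lambda>y. f (?i y))" and sn: "smooth_on S (\<lambda>y. \<nu> (?i y))"
      using F UA by (auto simp: frontal_on_def smooth_map_on_def o_def intro: smooth_on_subset[OF _ Ssub])
    define g where "g y = f (?i y) - P" for y
    define n where "n y = \<nu> (?i y)" for y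
    have sg: "smooth_on S g"
      unfolding g_def by (intro smooth_on_minus oS sf smooth_on_const)
    have sn: "smooth_on S n" using sn by (simp add: n_def[abs_def])
    have gn: "g y \<bullet> n y \<noteq> 0" "g y \<noteq> 0" if "y \<in> S" for y
      using W(2)[OF iW[OF that]] gnz[OF iW[OF that]] by (auto simp: g_def n_def)
    define l where "l y = (g y \<bullet> g y) * inverse (2 * (g y \<bullet> n y))" for y
    note inner = smooth_on_bilinear[OF oS bounded_bilinear_inner sg]
    note mult = smooth_on_bilinear[OF oS bounded_bilinear_mult]
    have sl: "smooth_on S l"
      unfolding l_def
      by (rule mult[OF inner[OF sg] smooth_on_inverse[OF oS mult[OF smooth_on_const inner[OF sn]]]])
         (use gn in auto)
    define a where "a y = g y - l y *\<^sub>R n y + P" for y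
    note scale = smooth_on_bilinear[OF oS bounded_bilinear_scaleR]
    have sa: "smooth_on S a"
      unfolding a_def
      by (rule smooth_on_add[OF oS smooth_on_minus[OF oS sg scale[OF sl sn]] smooth_on_const])
    have ea: "a = ?a \<circ> ?i"
      unfolding a_def g_def n_def l_def power2_norm_eq_inner divide_inverse o_def by (rule ext) simp
    have eb: "(\<lambda>y. inverse (norm (g y)) *\<^sub>R g y) = ?b \<circ> ?i"
      by (rule ext) (simp add: g_def)
    have "smooth_on S (\<lambda>y. inverse (norm (g y)) *\<^sub>R g y)"
      by (rule scale[OF smooth_on_inverse[OF oS smooth_on_norm[OF oS sg]] sg]) (use gn in auto)
    then have sb: "smooth_on S (?b \<circ> ?i)" using eb by simp
    have "frechet_derivative (?a \<circ> ?i) (at (\<kappa> x)) v \<bullet> ?b x = 0" if x: "x \<in> W" "x \<in> U" for x v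
    proof -
      let ?y = "\<kappa> x"
      have y: "?y \<in> S" using x by (auto simp: S_def)
      have ix: "?i ?y = x" using chart_inj[OF c] x by simp
      let ?D = "\<lambda>h. frechet_derivative h (at ?y)"
      note dg = smooth_on_has_derivative[OF sg y] and dn = smooth_on_has_derivative[OF sn y]
        and dl = smooth_on_has_derivative[OF sl y]
      have da: "(a has_derivative (\<lambda>v. ?D g v - (l ?y *\<^sub>R ?D n v + ?D l v *\<^sub>R n ?y))) (at ?y)"
        unfolding a_def
        using has_derivative_add[OF has_derivative_diff[OF dg has_derivative_scaleR[OF dl dn]] has_derivative_const[of P]]
        by simp
      have dav: "?D a v = ?D g v - (l ?y *\<^sub>R ?D n v + ?D l v *\<^sub>R n ?y)"
        by (rule fun_cong[OF frechet_derivative_at[OF da], symmetric])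
      have "((\<lambda>y. g y + P) has_derivative ?D g) (at ?y)"
        using has_derivative_add[OF dg has_derivative_const[of P]] by simp
      then have "((f \<circ> ?i) has_derivative ?D g) (at ?y)"
        by (simp add: g_def o_def)
      from frechet_derivative_at[OF this] have "?D (f \<circ> ?i) = ?D g" by (rule sym)
      moreover have "?D (f \<circ> ?i) v \<bullet> \<nu> x = 0"
        using F UA x WX unfolding frontal_on_def by blast
      ultimately have orth: "?D g v \<bullet> n ?y = 0" by (simp add: n_def ix)
      have e: "2 * (l z * (g z \<bullet> n z)) = g z \<bullet> g z" if "z \<in> S" for z
        using gn(1)[OF that] by (simp add: l_def)
      have d1: "((\<lambda>z. 2 * (l z * (g z \<bullet> n z))) has_derivative
          (\<lambda>v. 2 * (l ?y * (g ?y \<bullet> ?D n v + ?D g v \<bullet> n ?y) + ?D l v * (g ?y \<bullet> n ?y)))) (at ?y)"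
        by (intro has_derivative_mult_right has_derivative_mult has_derivative_inner dl dg dn)
      have d2: "((\<lambda>z. g z \<bullet> g z) has_derivative (\<lambda>v. g ?y \<bullet> ?D g v + ?D g v \<bullet> g ?y)) (at ?y)"
        by (intro has_derivative_inner dg)
      have "((\<lambda>z. g z \<bullet> g z) has_derivative
          (\<lambda>v. 2 * (l ?y * (g ?y \<bullet> ?D n v + ?D g v \<bullet> n ?y) + ?D l v * (g ?y \<bullet> n ?y)))) (at ?y)"
        using has_derivative_transform_within_open[OF d1 oS y e] .
      from has_derivative_unique[OF this d2]
      have "2 * (l ?y * (g ?y \<bullet> ?D n v + ?D g v \<bullet> n ?y) + ?D l v * (g ?y \<bullet> n ?y))
          = g ?y \<bullet> ?D g v + ?D g v \<bullet> g ?y" by (rule fun_cong)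
      then have "?D a v \<bullet> g ?y = 0"
        unfolding dav using orth
        by (simp add: inner_diff_left inner_add_left inner_diff_right inner_add_right inner_commute)
      then show ?thesis
        unfolding ea by (simp add: g_def ix)
    qed
    moreover have "smooth_on S (?a \<circ> ?i)" using sa unfolding ea .
    ultimately show ?thesis using sb unfolding S_def by (intro conjI ballI allI impI) assumption+
  qed
  have norm1: "?b ` W \<subseteq> sphere 0 1" using gnz by auto
  show ?thesis
    unfolding frontal_on_def anti_orthotomic_def smooth_map_on_def prod.case
  proof (intro conjI norm1 ballI; clarify)
    show "smooth_on (\<kappa> ` (U \<inter> W)) (?a \<circ> inv_into U \<kappa>)" if "(U, \<kappa>) \<in> A" for U \<kappa>
      by (rule main[OF that, THEN conjunct1])
    show "smooth_on (\<kappa> ` (U \<inter> W)) (?b \<circ> inv_into U \<kappa>)" if "(U, \<kappa>) \<in> A" for U \<kappa>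
      by (rule main[OF that, THEN conjunct2, THEN conjunct1])
    show "frechet_derivative (?a \<circ> inv_into U \<kappa>) (at (\<kappa> x)) v \<bullet> ?b x = 0"
      if "x \<in> W" "(U, \<kappa>) \<in> A" "x \<in> U" for x U \<kappa> v
      by (rule main[OF that(2), THEN conjunct2, THEN conjunct2, rule_format, OF that(1,3)])
  qed
qed

section \<open>Openings\<close>

text \<open>
  Germs are represented by functions, a germ being determined by any representative near the base
  point. A 1-form on \<open>\<real>\<^sup>n\<close> sends a point to a linear functional.
\<close>

definition one_form_germs :: "(real^'n \<Rightarrow> real^'n \<Rightarrow> real) set" where
  "one_form_germs = {\<omega>. (\<forall>\<^sub>F x in nhds 0. linear (\<omega> x)) \<and> (\<forall>v. smooth_germ (\<lambda>x. \<omega> x v) 0)}"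

definition ext_d :: "(real^'n \<Rightarrow> real) \<Rightarrow> real^'n \<Rightarrow> real^'n \<Rightarrow> real" where
  "ext_d g x = frechet_derivative g (at x)"

definition jacobi_module :: "(real^'n \<Rightarrow> real^'n) \<Rightarrow> (real^'n \<Rightarrow> real^'n \<Rightarrow> real) set" where
  "jacobi_module \<phi> = {\<omega> \<in> one_form_germs. \<exists>a :: 'n \<Rightarrow> real^'n \<Rightarrow> real.
     (\<forall>i. smooth_germ (a i) 0) \<and>
     (\<forall>\<^sub>F x in nhds 0. \<forall>v. \<omega> x v = (\<Sum>i\<in>UNIV. a i x * ext_d (\<lambda>y. \<phi> y $ i) x v))}"

definition ramification_module :: "(real^'n \<Rightarrow> real^'n) \<Rightarrow> (real^'n \<Rightarrow> real) set" where
  "ramification_module \<phi> = {\<delta>. smooth_germ \<delta> 0 \<and> ext_d \<delta> \<in> jacobi_module \<phi>}"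

definition is_opening :: "(real^'n \<Rightarrow> real^'n) \<Rightarrow> (real^'n \<Rightarrow> (real^'n) \<times> real) \<Rightarrow> bool" where
  "is_opening \<phi> F \<longleftrightarrow>
     smooth_germ \<phi> 0 \<and> \<phi> 0 = 0 \<and> (\<forall>\<^sub>F y in nhds 0. fst (F y) = \<phi> y) \<and>
     snd (F 0) = 0 \<and> (\<lambda>y. snd (F y)) \<in> ramification_module \<phi>"

text \<open>
  For a map-germ \<open>g\<close> at \<open>x\<^sub>0\<close> between manifolds with atlases \<open>A\<close> and \<open>B\<close>, and \<open>F\<close> with values
  in the product of the target of \<open>g\<close> and the real line: the coordinates are translated so that
  the base points become the origin.
\<close>

definition is_opening_mfd ::
  "('a set \<times> ('a \<Rightarrow> real^'n)) set \<Rightarrow> ('b set \<times> ('b \<Rightarrow> real^'n)) set \<Rightarrow> 'a \<Rightarrow>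
   ('a \<Rightarrow> 'b) \<Rightarrow> ('a \<Rightarrow> 'b \<times> real) \<Rightarrow> bool" where
  "is_opening_mfd A B x\<^sub>0 g F \<longleftrightarrow>
     (\<forall>(U, \<kappa>)\<in>A. \<forall>(V, \<psi>)\<in>B. x\<^sub>0 \<in> U \<longrightarrow> g x\<^sub>0 \<in> V \<longrightarrow>
        (let p = (\<lambda>y. inv_into U \<kappa> (\<kappa> x\<^sub>0 + y)) in
          (\<forall>\<^sub>F y in nhds 0. g (p y) \<in> V \<and> fst (F (p y)) \<in> V) \<and>
          is_opening (\<lambda>y. \<psi> (g (p y)) - \<psi> (g x\<^sub>0))
            (\<lambda>y. (\<psi> (fst (F (p y))) - \<psi> (g x\<^sub>0), snd (F (p y)) - snd (F x\<^sub>0)))))"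

text \<open>
  The identification of the punctured space with the product of the unit sphere and the positive
  half-line.
\<close>

definition polar :: "real^'m \<Rightarrow> (real^'m) \<times> real" where
  "polar y = (y /\<^sub>R norm y, norm y)"

end

theory Submission
  imports Defs
begin

text \<open>
  Write \<open>f - P = r u\<close> with \<open>r = \<parallel>f - P\<parallel>\<close>. The frontal condition
  \<open>df \<bullet> \<nu> = 0\<close> becomes \<open>(u \<bullet> \<nu>) dr = - r (du \<bullet> \<nu>)\<close>, and \<open>u \<bullet> \<nu> \<noteq> 0\<close> near the base
  point. In a chart \<open>\<psi>\<close> of the sphere, \<open>u = \<theta> (\<psi> u)\<close> for the smooth parametrization
  \<open>\<theta> = \<psi>\<^sup>-\<^sup>1\<close>, so that \<open>du\<close>, and hence \<open>dr\<close>, is a combination of the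
  differentials of the components of \<open>\<psi> u\<close> with smooth coefficients.
\<close>

lemma smooth_on_frechet_derivative:
  assumes "smooth_on S f"
  shows "smooth_on S (\<lambda>x. frechet_derivative f (at x) v)"
  unfolding smooth_on_def
proof
  fix k
  have "Ck_on (Suc k) S f" using assms by (simp only: smooth_on_def)
  then show "Ck_on k S (\<lambda>x. frechet_derivative f (at x) v)" by simp
qed

lemma smooth_on_translate:
  assumes "open S" "smooth_on S f"
  shows "smooth_on {y. c + y \<in> S} (\<lambda>y. f (c + y))"
proof -
  have o: "open {y. c + y \<in> S}"
    using open_vimage[OF assms(1), of "\<lambda>y. c + y"] by (simp add: vimage_def continuous_intros)
  have "smooth_on {y. c + y \<in> S} (\<lambda>y. c + y)"
    by (rule smooth_on_add[OF o smooth_on_const smooth_on_linear[OF o bounded_linear_ident]])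
  then show ?thesis
    by (rule smooth_on_compose[OF o assms(1) _ assms(2)]) auto
qed

lemma smooth_on_imp_smooth_germ: "open S \<Longrightarrow> x \<in> S \<Longrightarrow> smooth_on S f \<Longrightarrow> smooth_germ f x"
  unfolding smooth_germ_def by blast

lemma ext_d_component:
  assumes "(\<phi> has_derivative D) (at x)"
  shows "ext_d (\<lambda>y. \<phi> y $ i) x v = D v $ i"
proof -
  have "((\<lambda>y. \<phi> y $ i) has_derivative (\<lambda>v. D v $ i)) (at x)"
    using bounded_linear.has_derivative[OF bounded_linear_vec_nth assms] .
  from frechet_derivative_at[OF this] show ?thesis
    unfolding ext_d_def by metis
qed

text \<open>Applied with \<open>L\<close> the derivative of \<open>\<theta>\<close> and
  \<open>w\<close> a value of the derivative of \<open>\<phi>\<close>: the coordinates of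
  \<open>w\<close> are then the values of the generators d\<phi>_i of the Jacobi module.\<close>

lemma linear_axis_expansion:
  fixes L :: "real^'n \<Rightarrow> 'b::real_vector"
  assumes "linear L"
  shows "L w = (\<Sum>i\<in>UNIV. (w $ i) *\<^sub>R L (axis i 1))"
proof -
  have "L w = L (\<Sum>i\<in>UNIV. (w $ i) *\<^sub>R axis i 1)"
    using basis_expansion[of w] by (simp add: scalar_mult_eq_scaleR)
  then show ?thesis by (simp only: linear_sum[OF assms] linear_cmul[OF assms])
qed

text \<open>The product rule turns orthogonality to \<open>m\<close> into a scalar equation that is
  linear in \<open>r' v\<close> with coefficient \<open>u y \<bullet> m\<close>; solving it
  expresses dr through du.\<close>

lemma radius_derivative_if_orthogonal:
  fixes u :: "'a::real_normed_vector \<Rightarrow> 'b::real_inner" and r :: "'a \<Rightarrow> real"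
  assumes dr: "(r has_derivative r') (at y)" and du: "(u has_derivative u') (at y)"
    and orth: "frechet_derivative (\<lambda>y. r y *\<^sub>R u y) (at y) v \<bullet> m = 0"
    and nz: "u y \<bullet> m \<noteq> 0"
  shows "r' v = - (r y / (u y \<bullet> m)) * (u' v \<bullet> m)"
proof -
  have "frechet_derivative (\<lambda>y. r y *\<^sub>R u y) (at y) v = r y *\<^sub>R u' v + r' v *\<^sub>R u y"
    using frechet_derivative_at[OF has_derivative_scaleR[OF dr du]] by metis
  with orth have "r y * (u' v \<bullet> m) + r' v * (u y \<bullet> m) = 0"
    by (simp add: inner_add_left)
  with nz show ?thesis by (simp add: field_simps)
qed

text \<open>The theorem in local coordinates: \<open>\<phi>\<close> stands for the Gauss map
  \<open>u\<close> read in a chart of the sphere, \<open>\<theta>\<close> for the inverse chart,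
  \<open>n\<close> for the Gauss map of the given frontal. Since \<open>u\<close> factors through
  \<open>\<phi>\<close>, du is a combination of the d\<phi>_i, and orthogonality carries this over
  to dr.\<close>

lemma radius_in_ramification_module:
  fixes u n :: "real^'n \<Rightarrow> 'b::euclidean_space" and r :: "real^'n \<Rightarrow> real"
    and \<phi> :: "real^'n \<Rightarrow> real^'n" and \<theta> :: "real^'n \<Rightarrow> 'b"
  assumes S: "open S" "0 \<in> S" and T: "open T"
    and smooth: "smooth_on S r" "smooth_on S n" "smooth_on S \<phi>" "smooth_on T \<theta>"
    and \<phi>T: "\<phi> ` S \<subseteq> T"
    and u: "\<And>y. y \<in> S \<Longrightarrow> u y = \<theta> (\<phi> y)"
    and nz: "\<And>y. y \<in> S \<Longrightarrow> u y \<bullet> n y \<noteq> 0"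
    and orth: "\<And>y v. y \<in> S \<Longrightarrow> frechet_derivative (\<lambda>y. r y *\<^sub>R u y) (at y) v \<bullet> n y = 0"
  shows "r \<in> ramification_module \<phi>"
proof -
  \<comment> \<open>The coefficient of d\<phi>_i that results from inserting the chain rule for
    \<open>\<theta>\<close> after \<open>\<phi>\<close> into dr = - (r / (u \<bullet> n)) (du
    \<bullet> n). Writing it with \<open>(- 1)\<close> and \<open>inverse\<close> makes it a product
    of smooth factors.\<close>
  define a where "a i y = (- 1) * ((r y * inverse (u y \<bullet> n y)) *
    (frechet_derivative \<theta> (at (\<phi> y)) (axis i 1) \<bullet> n y))" for i y
  note inner = smooth_on_bilinear[OF S(1) bounded_bilinear_inner]
    and mult = smooth_on_bilinear[OF S(1) bounded_bilinear_mult]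
    and \<phi>_compose = smooth_on_compose[OF S(1) T smooth(3) _ \<phi>T]
  have su: "smooth_on S u"
    by (rule smooth_on_cong[OF S(1) u[symmetric] \<phi>_compose[OF smooth(4)]])
  have sa: "smooth_on S (a i)" for i
    unfolding a_def
    by (intro mult inner smooth_on_const smooth su smooth_on_inverse S(1) nz
        \<phi>_compose smooth_on_frechet_derivative)
  have sum: "ext_d r y v = (\<Sum>i\<in>UNIV. a i y * ext_d (\<lambda>y. \<phi> y $ i) y v)" if y: "y \<in> S" for y v
  proof -
    let ?D\<phi> = "frechet_derivative \<phi> (at y)" and ?D\<theta> = "frechet_derivative \<theta> (at (\<phi> y))"
    have d\<phi>: "(\<phi> has_derivative ?D\<phi>) (at y)"
      by (rule smooth_on_has_derivative[OF smooth(3) y])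
    have d\<theta>: "(\<theta> has_derivative ?D\<theta>) (at (\<phi> y))"
      by (rule smooth_on_has_derivative[OF smooth(4)]) (use \<phi>T y in auto)
    have du: "(u has_derivative (\<lambda>v. ?D\<theta> (?D\<phi> v))) (at y)"
      by (rule has_derivative_transform_within_open[OF has_derivative_compose[OF d\<phi> d\<theta>] S(1) y u[symmetric]])
    have "ext_d r y v = - (r y / (u y \<bullet> n y)) * (?D\<theta> (?D\<phi> v) \<bullet> n y)"
      unfolding ext_d_def
      by (rule radius_derivative_if_orthogonal[OF smooth_on_has_derivative[OF smooth(1) y] du orth[OF y] nz[OF y]])
    also have "?D\<theta> (?D\<phi> v) = (\<Sum>i\<in>UNIV. (?D\<phi> v $ i) *\<^sub>R ?D\<theta> (axis i 1))"
      by (rule linear_axis_expansion[OF has_derivative_linear[OF d\<theta>]])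
    finally show ?thesis
      by (simp add: a_def ext_d_component[OF d\<phi>] inner_sum_left sum_distrib_left divide_inverse
          mult_ac flip: sum_negf)
  qed
  have near: "\<forall>\<^sub>F y in nhds 0. y \<in> S"
    using S by (rule eventually_nhds_in_open)
  have "linear (ext_d r y)" if "y \<in> S" for y
    unfolding ext_d_def using has_derivative_linear[OF smooth_on_has_derivative[OF smooth(1) that]] .
  then have "\<forall>\<^sub>F y in nhds 0. linear (ext_d r y)"
    by (rule eventually_mono[OF near])
  moreover have "smooth_germ (\<lambda>y. ext_d r y v) 0" for v
    unfolding ext_d_def
    by (rule smooth_on_imp_smooth_germ[OF S smooth_on_frechet_derivative[OF smooth(1)]])
  ultimately have "ext_d r \<in> one_form_germs"
    by (simp add: one_form_germs_def)
  moreover have "\<forall>\<^sub>F y in nhds 0. \<forall>v. ext_d r y v = (\<Sum>i\<in>UNIV. a i y * ext_d (\<lambda>y. \<phi> y $ i) y v)"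
    by (rule eventually_mono[OF near]) (intro allI sum)
  ultimately have "ext_d r \<in> jacobi_module \<phi>"
    unfolding jacobi_module_def
    by (intro CollectI conjI exI[of _ a] allI smooth_on_imp_smooth_germ[OF S sa])
  then show ?thesis
    unfolding ramification_module_def by (intro CollectI conjI smooth_on_imp_smooth_germ[OF S smooth(1)])
qed

text \<open>Both functions have the same derivatives at each point, so the choice behind
  \<open>frechet_derivative\<close> returns the same value, even at points where no derivative
  exists.\<close>

lemma ext_d_diff_const: "ext_d (\<lambda>y. g y - c) = ext_d g"
proof -
  have "((\<lambda>y. g y - c) has_derivative D) (at x) \<longleftrightarrow> (g has_derivative D) (at x)" for D x
    using has_derivative_add_const[of g D "at x" "- c"]
      has_derivative_add_const[of "\<lambda>y. g y - c" D "at x" c] by auto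
  then show ?thesis
    unfolding ext_d_def frechet_derivative_def by (intro ext) simp
qed

lemma smooth_germ_diff_const:
  assumes "smooth_germ g x"
  shows "smooth_germ (\<lambda>y. g y - c) x"
proof -
  obtain U where U: "open U" "x \<in> U" "smooth_on U g"
    using assms unfolding smooth_germ_def by blast
  from smooth_on_minus[OF U(1,3) smooth_on_const] show ?thesis
    by (rule smooth_on_imp_smooth_germ[OF U(1,2)])
qed

text \<open>Constants vanish under d, so neither d\<delta> nor the generators of the Jacobi module
  change. This supplies the translation of base points demanded by
  \<open>is_opening_mfd\<close>.\<close>

lemma ramification_module_translate:
  assumes "\<delta> \<in> ramification_module \<phi>"
  shows "(\<lambda>y. \<delta> y - c) \<in> ramification_module (\<lambda>y. \<phi> y - b)"
proof -
  have "ext_d (\<lambda>y. (\<phi> y - b) $ i) = ext_d (\<lambda>y. \<phi> y $ i)" for i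
    using ext_d_diff_const[of "\<lambda>y. \<phi> y $ i" "b $ i"] by simp
  then show ?thesis
    using assms by (simp add: ramification_module_def jacobi_module_def ext_d_diff_const
        smooth_germ_diff_const)
qed

theorem theorem4:
  fixes X :: "'a topology"
    and A :: "('a set \<times> ('a \<Rightarrow> real^'n)) set"
    and f \<nu> :: "'a \<Rightarrow> real^'m"
    and x\<^sub>0 :: 'a
    and P :: "real^'m"
  assumes "CARD('m) = CARD('n) + 1"
    and "smooth_manifold X A"
    and "frontal_on A (topspace X) (f, \<nu>)"
    and "x\<^sub>0 \<in> topspace X"
    and "(f x\<^sub>0 - P) \<bullet> \<nu> x\<^sub>0 \<noteq> 0"
  shows "is_opening_mfd A sphere_charts x\<^sub>0
           (snd (anti_orthotomic P (f, \<nu>))) (\<lambda>x. polar (f x - P))"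
proof -
  let ?u = "\<lambda>x. (f x - P) /\<^sub>R norm (f x - P)"
  \<comment> \<open>For one pair of charts, with only the source recentred at the origin; the values
    in the target are translated at the very end.\<close>
  have main: "(\<forall>\<^sub>F y in nhds 0. ?u (inv_into U \<kappa> (\<kappa> x\<^sub>0 + y)) \<in> V) \<and>
      smooth_germ (\<lambda>y. \<psi> (?u (inv_into U \<kappa> (\<kappa> x\<^sub>0 + y)))) 0 \<and>
      (\<lambda>y. norm (f (inv_into U \<kappa> (\<kappa> x\<^sub>0 + y)) - P))
        \<in> ramification_module (\<lambda>y. \<psi> (?u (inv_into U \<kappa> (\<kappa> x\<^sub>0 + y))))"
    if UA: "(U, \<kappa>) \<in> A" and V\<psi>: "(V, \<psi>) \<in> sphere_charts" and xU: "x\<^sub>0 \<in> U" and uV: "?u x\<^sub>0 \<in> V"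
    for U V and \<kappa> :: "'a \<Rightarrow> real^'n" and \<psi> :: "real^'m \<Rightarrow> real^'n"
  proof -
    have c: "chart X U \<kappa>" using assms(2) UA by (auto simp: smooth_manifold_def)
    then have o\<kappa>: "open (\<kappa> ` U)" and UX: "U \<inter> topspace X = U"
      by (auto simp: chart_def dest: openin_subset)
    define p where "p y = inv_into U \<kappa> (\<kappa> x\<^sub>0 + y)" for y
    have p0: "p 0 = x\<^sub>0" using chart_inj[OF c] xU by (simp add: p_def)
    define S0 where "S0 = {y. \<kappa> x\<^sub>0 + y \<in> \<kappa> ` U}"
    have oS0: "open S0"
      unfolding S0_def using open_vimage[OF o\<kappa>, of "\<lambda>y. \<kappa> x\<^sub>0 + y"]
      by (simp add: vimage_def continuous_intros)
    have pU: "p y \<in> U" "\<kappa> (p y) = \<kappa> x\<^sub>0 + y" if "y \<in> S0" for y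
      using that by (auto simp: p_def S0_def intro: inv_into_into f_inv_into_f)
    define g where "g y = f (p y) - P" for y
    define n where "n y = \<nu> (p y)" for y
    define u where "u y = g y /\<^sub>R norm (g y)" for y
    have sf: "smooth_on (\<kappa> ` U) (\<lambda>z. f (inv_into U \<kappa> z))" "smooth_on (\<kappa> ` U) (\<lambda>z. \<nu> (inv_into U \<kappa> z))"
      using assms(3) UA UX by (force simp: frontal_on_def smooth_map_on_def o_def)+
    have sg0: "smooth_on S0 g"
      unfolding g_def p_def S0_def
      by (rule smooth_on_minus[OF oS0[unfolded S0_def] smooth_on_translate[OF o\<kappa> sf(1)] smooth_on_const])
    have sn0: "smooth_on S0 n"
      unfolding n_def p_def S0_def by (rule smooth_on_translate[OF o\<kappa> sf(2)])
    \<comment> \<open>The condition at the base point is open, and on \<open>S1\<close> it forces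
      \<open>g\<close> to be nonzero, so that the norm of \<open>g\<close> and the direction
      \<open>u\<close> are smooth there.\<close>
    define S1 where "S1 = {y \<in> S0. g y \<bullet> n y \<noteq> 0}"
    have oS1: "open S1"
    proof -
      have "continuous_on S0 (\<lambda>y. g y \<bullet> n y)"
        by (intro continuous_on_inner smooth_on_imp_continuous_on sg0 sn0)
      from continuous_open_preimage[OF this oS0, of "- {0}"] show ?thesis
        by (simp add: S1_def vimage_def Int_def open_Compl)
    qed
    have S10: "S1 \<subseteq> S0" by (auto simp: S1_def)
    note sg1 = smooth_on_subset[OF sg0 S10]
    have g1: "g y \<noteq> 0" if "y \<in> S1" for y using that by (auto simp: S1_def)
    have su1: "smooth_on S1 u"
      unfolding u_def
      by (intro smooth_on_bilinear[OF oS1 bounded_bilinear_scaleR] smooth_on_inverse smooth_on_norm oS1 sg1)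
         (use g1 in auto)
    have cV: "chart (top_of_set (sphere 0 1)) V \<psi>" and s\<theta>: "smooth_on (\<psi> ` V) (inv_into V \<psi>)"
      using V\<psi> by (auto simp: sphere_charts_def)
    obtain O' where O': "open O'" "V = sphere 0 1 \<inter> O'"
      using cV by (auto simp: chart_def openin_open)
    obtain W h where W: "open W" "?u x\<^sub>0 \<in> W" "smooth_on W h" "\<forall>q\<in>W \<inter> V. h q = \<psi> q"
      using V\<psi> uV by (fastforce simp: sphere_charts_def)
    \<comment> \<open>\<open>V\<close> is open only relative to the sphere, hence the ambient open
      set \<open>O'\<close>: a unit vector in \<open>O'\<close> lies in \<open>V\<close>. The set
      \<open>W\<close> keeps \<open>u\<close> where the ambient smooth map \<open>h\<close> agrees
      with \<open>\<psi>\<close>, which yields smoothness of \<open>\<psi>\<close> after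
      \<open>u\<close>.\<close>
    define S where "S = S1 \<inter> u -` (O' \<inter> W)"
    have oS: "open S"
      unfolding S_def
      by (rule continuous_open_preimage[OF smooth_on_imp_continuous_on[OF su1] oS1]) (use O' W in blast)
    have S1: "S \<subseteq> S1" and S0: "S \<subseteq> S0" using S10 by (auto simp: S_def)
    have "0 \<in> S0" using xU by (auto simp: S0_def)
    then have zS: "0 \<in> S"
      using assms(5) uV O'(2) W(2) by (simp add: S_def S1_def u_def g_def n_def p0)
    have uVW: "u y \<in> V" "u y \<in> W" if "y \<in> S" for y
      using that g1 S1 by (auto simp: S_def O'(2) u_def)
    have s\<phi>: "smooth_on S (\<lambda>y. \<psi> (u y))"
    proof (rule smooth_on_cong[OF oS])
      show "smooth_on S (\<lambda>y. h (u y))"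
        by (rule smooth_on_compose[OF oS W(1) smooth_on_subset[OF su1 S1] W(3)]) (use uVW in auto)
    qed (use uVW W(4) in auto)
    \<comment> \<open>Translating the argument and subtracting \<open>P\<close> do not affect the
      derivative, so this is the frontal condition at the point \<open>p y\<close>, whose coordinate
      is \<open>\<kappa> x\<^sub>0 + y\<close>.\<close>
    have orth: "frechet_derivative g (at y) v \<bullet> n y = 0" if y: "y \<in> S" for y v
    proof -
      let ?F = "f \<circ> inv_into U \<kappa>" and ?z = "\<kappa> x\<^sub>0 + y"
      have z: "?z \<in> \<kappa> ` U" using y S0 by (auto simp: S0_def)
      have dF: "(?F has_derivative frechet_derivative ?F (at ?z)) (at ?z)"
        using smooth_on_has_derivative[OF sf(1) z] by (simp add: o_def)
      have "((\<lambda>y. \<kappa> x\<^sub>0 + y) has_derivative (\<lambda>v. v)) (at y)"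
        by (auto intro!: derivative_eq_intros)
      from has_derivative_diff[OF has_derivative_compose[OF this dF] has_derivative_const[of P]]
      have "(g has_derivative frechet_derivative ?F (at ?z)) (at y)"
        by (simp add: g_def[abs_def] p_def)
      then have "frechet_derivative g (at y) = frechet_derivative ?F (at ?z)"
        by (rule frechet_derivative_at[symmetric])
      moreover have "frechet_derivative ?F (at (\<kappa> (p y))) v \<bullet> \<nu> (p y) = 0"
        using assms(3) UA pU(1)[of y] UX y S0 unfolding frontal_on_def by blast
      ultimately show ?thesis
        using pU(2)[of y] y S0 by (auto simp: n_def)
    qed
    \<comment> \<open>At zeros of \<open>g\<close> both sides vanish, so the polar decomposition is
      an equality of functions and can be rewritten inside
      \<open>frechet_derivative\<close>.\<close>
    have gu: "(\<lambda>y. norm (g y) *\<^sub>R u y) = g"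
    proof
      show "norm (g y) *\<^sub>R u y = g y" for y by (cases "g y = 0") (simp_all add: u_def)
    qed
    have "(\<lambda>y. norm (g y)) \<in> ramification_module (\<lambda>y. \<psi> (u y))"
    \<comment> \<open>The inverse chart \<open>inv_into V \<psi>\<close> serves as
      \<open>\<theta>\<close>, on the open image of \<open>V\<close> under
      \<open>\<psi>\<close>.\<close>
    proof (rule radius_in_ramification_module[where u = u and n = n, OF oS zS _ _ _ s\<phi> s\<theta>])
      show "open (\<psi> ` V)" using cV by (simp add: chart_def)
      show "smooth_on S (\<lambda>y. norm (g y))"
        by (rule smooth_on_norm[OF oS smooth_on_subset[OF sg1 S1]]) (use g1 S1 in auto)
      show "smooth_on S n" by (rule smooth_on_subset[OF sn0 S0])
      show "u y = inv_into V \<psi> (\<psi> (u y))" if "y \<in> S" for y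
        using chart_inj[OF cV] uVW(1)[OF that] by simp
      show "u y \<bullet> n y \<noteq> 0" if "y \<in> S" for y
        using that S1 g1 by (auto simp: u_def S1_def)
      show "frechet_derivative (\<lambda>y. norm (g y) *\<^sub>R u y) (at y) v \<bullet> n y = 0" if "y \<in> S" for y v
        unfolding gu by (rule orth[OF that])
    qed (use uVW in auto)
    moreover have "\<forall>\<^sub>F y in nhds 0. u y \<in> V"
      by (rule eventually_mono[OF eventually_nhds_in_open[OF oS zS]]) (rule uVW(1))
    ultimately show ?thesis
      using smooth_on_imp_smooth_germ[OF oS zS s\<phi>] by (simp add: u_def g_def p_def)
  qed
  show ?thesis
    unfolding is_opening_mfd_def Let_def
  proof clarify
    fix U V and \<kappa> :: "'a \<Rightarrow> real^'n" and \<psi> :: "real^'m \<Rightarrow> real^'n"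
    assume chs: "(U, \<kappa>) \<in> A" "(V, \<psi>) \<in> sphere_charts" "x\<^sub>0 \<in> U"
      "snd (anti_orthotomic P (f, \<nu>)) x\<^sub>0 \<in> V"
    have "inv_into U \<kappa> (\<kappa> x\<^sub>0) = x\<^sub>0"
      using assms(2) chs(1,3) chart_inj by (fastforce simp: smooth_manifold_def)
    moreover have "?u x\<^sub>0 \<in> V" using chs(4) by (simp add: anti_orthotomic_def)
    note main[OF chs(1-3) this]
    \<comment> \<open>The first component of \<open>polar\<close> is the Gauss map of the
      anti-orthotomic, so both membership conditions are the one in \<open>main\<close>; the
      translated germs vanish at the origin because the local inverse of \<open>\<kappa>\<close>
      returns \<open>x\<^sub>0\<close> there.\<close>
    ultimately show "(\<forall>\<^sub>F y in nhds 0.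
          snd (anti_orthotomic P (f, \<nu>)) (inv_into U \<kappa> (\<kappa> x\<^sub>0 + y)) \<in> V \<and>
          fst (polar (f (inv_into U \<kappa> (\<kappa> x\<^sub>0 + y)) - P)) \<in> V) \<and>
        is_opening
          (\<lambda>y. \<psi> (snd (anti_orthotomic P (f, \<nu>)) (inv_into U \<kappa> (\<kappa> x\<^sub>0 + y))) -
            \<psi> (snd (anti_orthotomic P (f, \<nu>)) x\<^sub>0))
          (\<lambda>y. (\<psi> (fst (polar (f (inv_into U \<kappa> (\<kappa> x\<^sub>0 + y)) - P))) -
              \<psi> (snd (anti_orthotomic P (f, \<nu>)) x\<^sub>0),
            snd (polar (f (inv_into U \<kappa> (\<kappa> x\<^sub>0 + y)) - P)) - snd (polar (f x\<^sub>0 - P))))"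
      by (simp add: is_opening_def anti_orthotomic_def polar_def ramification_module_translate
          smooth_germ_diff_const)
  qed
qed

end
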